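(* Let $k\in L^1_{loc}(\mathbb{R}_+)$ be a nonnegative function whose Laplace transform $\widehat k(s)$ exists for all $s>0$, is a Stieltjes function, and satisfies $\widehat{k}(s)\to 0$, $s\widehat{k}(s)\to \infty$ as $s\to \infty$ and $\widehat{k}(s)\to \infty$, $s\widehat{k}(s)\to 0$ as $s\to 0^+$. Let $\Omega\subset\mathbb{R}^d$ be a bounded domain with sufficiently smooth boundary, let $T>0$, and let $q\in C[0,T]$ be a given function with $q(t)\ge q_0>0$ for all $t\in[0,T]$. Consider the inverse source problem of determining, from given $h$, a pair $\{f(x),u(x,t)\}$ with $f\in L^2(\Omega)$ such that $$\mathbb{D}_{(k)}u(x,t)=\Delta u(x,t)+f(x)q(t),\quad x\in\Omega,\ t\in(0,T),$$ $$u(x,t)=0,\ x\in\partial\Omega,\ t\in(0,T);\qquad u(x,0)=0,\ x\in\Omega;\qquad u(x,T)=h(x),\ x\in\overline\Omega.$$ Then the solution $\{f,u\}$ of this problem is unique (that is, for each $h$ there is at most one solution pair).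
   Context: Here $\mathbb{R}_+=[0,\infty)$ and $\widehat{f}(s)=\int_0^\infty e^{-st}f(t)\,dt$ denotes the Laplace transform. The operator $\mathbb{D}_{(k)}$ acts in the time variable: $(\mathbb{D}_{(k)} w)(t)=\frac{d}{dt}\int_0^t k(t-\tau)w(\tau)\,d\tau-k(t)w(0)$. A function $f$ on $(0,\infty)$ is completely monotone if it is infinitely differentiable and $(-1)^n f^{(n)}(t)\ge 0$ for all $n=0,1,\dots$ and $t>0$. A function $\varphi$ on $(0,\infty)$ is a Stieltjes function if $\varphi(s)=\frac{a}{s}+b+\int_0^\infty e^{-s\tau}\psi_0(\tau)\,d\tau$ for some $a,b\ge 0$ and some completely monotone $\psi_0$ whose Laplace transform exists for all $s>0$. The Laplace operator $\Delta$ is taken in $L^2(\Omega)$ with domain $D(\Delta)=H_0^1(\Omega)\cap H^2(\Omega)$ and eigensystem $\{-\lambda_n,\varphi_n\}_{n=1}^\infty$, where $0<\lambda_1\le\lambda_2\le\dots$, $\lambda_n\to\infty$, and $\{\varphi_n\}$ is an orthonormal basis of $L^2(\Omega)$; $(\cdot,\cdot)$ is the inner product of $L^2(\Omega)$. For $\lambda>0$, the impulse-response solution $v(t;\lambda)$, $t>0$, of the relaxation equation $(\mathbb{D}_{(k)}w)(t)+\lambda w(t)=f(t)$ is the continuous function on $(0,\infty)$ with Laplace transform $\widehat v(s;\lambda)=\frac{1}{s\widehat k(s)+\lambda}$, $s>0$. The solution of the direct problem with zero initial value and source $f(x)q(t)$ is understood as given by the eigenfunction expansion (in $L^2(\Omega)$)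 $$u(x,t)=\sum_{n=1}^\infty f_n\left(\int_0^t v(t-\tau;\lambda_n)q(\tau)\,d\tau\right)\varphi_n(x),\qquad f_n=(f,\varphi_n).$$ *)

theory Defs
  imports "HOL-Analysis.Analysis"
begin

subsection \<open>Laplace transform, completely monotone and Stieltjes functions\<close>

definition laplace_exists :: "(real \<Rightarrow> real) \<Rightarrow> real \<Rightarrow> bool" where
  "laplace_exists f s \<longleftrightarrow> set_integrable lebesgue {0<..} (\<lambda>t. exp (- (s * t)) * f t)"

definition laplace :: "(real \<Rightarrow> real) \<Rightarrow> real \<Rightarrow> real" where
  "laplace f s = (LINT t:{0<..}|lebesgue. exp (- (s * t)) * f t)"

definition completely_monotone :: "(real \<Rightarrow> real) \<Rightarrow> bool" where
  "completely_monotone f \<longleftrightarrow>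
    (\<forall>n. \<forall>t>0. ((deriv ^^ n) f) differentiable (at t) \<and> 0 \<le> (-1) ^ n * (deriv ^^ n) f t)"

definition stieltjes_function :: "(real \<Rightarrow> real) \<Rightarrow> bool" where
  "stieltjes_function \<phi> \<longleftrightarrow>
    (\<exists>a b \<psi>. 0 \<le> a \<and> 0 \<le> b \<and> completely_monotone \<psi> \<and> (\<forall>s>0. laplace_exists \<psi> s) \<and>
      (\<forall>s>0. \<phi> s = a / s + b + laplace \<psi> s))"

definition impulse_response :: "(real \<Rightarrow> real) \<Rightarrow> real \<Rightarrow> (real \<Rightarrow> real) \<Rightarrow> bool" where
  "impulse_response k \<mu> w \<longleftrightarrow> continuous_on {0<..} w \<and>
    (\<forall>s>0. laplace_exists w s \<and> laplace w s = 1 / (s * laplace k s + \<mu>))"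

subsection \<open>Smooth functions and domains\<close>

text \<open>Continuous differentiability of order \<open>m\<close> on the whole space, by iterated partial derivatives.\<close>

fun Ck :: "nat \<Rightarrow> ('a::euclidean_space \<Rightarrow> real) \<Rightarrow> bool" where
  "Ck 0 f \<longleftrightarrow> continuous_on UNIV f"
| "Ck (Suc m) f \<longleftrightarrow> (\<forall>x. f differentiable (at x)) \<and>
     (\<forall>i\<in>Basis. Ck m (\<lambda>x. frechet_derivative f (at x) i))"

definition test_function :: "'a::euclidean_space set \<Rightarrow> ('a \<Rightarrow> real) \<Rightarrow> bool" where
  "test_function \<Omega> \<psi> \<longleftrightarrow> (\<forall>m. Ck m \<psi>) \<and> compact (closure {x. \<psi> x \<noteq> 0}) \<and>
     closure {x. \<psi> x \<noteq> 0} \<subseteq> \<Omega>"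

text \<open>Near each boundary point, \<open>\<Omega>\<close> is the region above the graph, in some unit direction \<open>e\<close>, of a
  \<open>C\<^sup>m\<close> function \<open>\<gamma>\<close> on the hyperplane orthogonal to \<open>e\<close>; \<open>\<gamma>\<close> is defined on the whole space, but
  only its values on that hyperplane are used.\<close>

definition Ck_boundary :: "nat \<Rightarrow> 'a::euclidean_space set \<Rightarrow> bool" where
  "Ck_boundary m \<Omega> \<longleftrightarrow> (\<forall>p\<in>frontier \<Omega>. \<exists>r>0. \<exists>e \<gamma>. norm e = 1 \<and> Ck m \<gamma> \<and>
     \<Omega> \<inter> ball p r = {x \<in> ball p r. \<gamma> (x - (x \<bullet> e) *\<^sub>R e) < x \<bullet> e})"

subsection \<open>The space \<open>L\<^sup>2(\<Omega>)\<close> and Sobolev spaces\<close>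

text \<open>Elements of \<open>L\<^sup>2(\<Omega>)\<close> are represented by functions, so equality in that space is equality
  almost everywhere in \<open>\<Omega>\<close>.\<close>

definition L2 :: "'a::euclidean_space set \<Rightarrow> ('a \<Rightarrow> real) set" where
  "L2 \<Omega> = {f \<in> borel_measurable (lebesgue_on \<Omega>). integrable (lebesgue_on \<Omega>) (\<lambda>x. (f x)\<^sup>2)}"

definition L2_inner :: "'a::euclidean_space set \<Rightarrow> ('a \<Rightarrow> real) \<Rightarrow> ('a \<Rightarrow> real) \<Rightarrow> real" where
  "L2_inner \<Omega> f g = (LINT x|lebesgue_on \<Omega>. f x * g x)"

definition L2_norm :: "'a::euclidean_space set \<Rightarrow> ('a \<Rightarrow> real) \<Rightarrow> real" where
  "L2_norm \<Omega> f = sqrt (L2_inner \<Omega> f f)"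

definition has_weak_pderiv ::
  "'a::euclidean_space set \<Rightarrow> 'a \<Rightarrow> ('a \<Rightarrow> real) \<Rightarrow> ('a \<Rightarrow> real) \<Rightarrow> bool" where
  "has_weak_pderiv \<Omega> i f g \<longleftrightarrow> f \<in> L2 \<Omega> \<and> g \<in> L2 \<Omega> \<and>
     (\<forall>\<psi>. test_function \<Omega> \<psi> \<longrightarrow>
        L2_inner \<Omega> f (\<lambda>x. frechet_derivative \<psi> (at x) i) = - L2_inner \<Omega> g \<psi>)"

definition sobolev_H1 :: "'a::euclidean_space set \<Rightarrow> ('a \<Rightarrow> real) set" where
  "sobolev_H1 \<Omega> = {f \<in> L2 \<Omega>. \<forall>i\<in>Basis. \<exists>g. has_weak_pderiv \<Omega> i f g}"

definition sobolev_H2 :: "'a::euclidean_space set \<Rightarrow> ('a \<Rightarrow> real) set" where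
  "sobolev_H2 \<Omega> = {f \<in> L2 \<Omega>. \<forall>i\<in>Basis. \<exists>g\<in>sobolev_H1 \<Omega>. has_weak_pderiv \<Omega> i f g}"

text \<open>The closure of the test functions in the norm of \<open>H\<^sup>1(\<Omega>)\<close>.\<close>

definition sobolev_H10 :: "'a::euclidean_space set \<Rightarrow> ('a \<Rightarrow> real) set" where
  "sobolev_H10 \<Omega> = {f \<in> sobolev_H1 \<Omega>. \<exists>\<psi>. (\<forall>m::nat. test_function \<Omega> (\<psi> m)) \<and>
     (\<lambda>m. L2_norm \<Omega> (\<lambda>x. \<psi> m x - f x)) \<longlonglongrightarrow> 0 \<and>
     (\<forall>i\<in>Basis. \<exists>g. has_weak_pderiv \<Omega> i f g \<and>
        (\<lambda>m. L2_norm \<Omega> (\<lambda>x. frechet_derivative (\<psi> m) (at x) i - g x)) \<longlonglongrightarrow> 0)}"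

subsection \<open>The Dirichlet Laplacian and its eigensystem\<close>

text \<open>The graph of \<open>\<Delta>\<close> with domain \<open>H\<^sub>0\<^sup>1(\<Omega>) \<inter> H\<^sup>2(\<Omega>)\<close>: \<open>f\<close> lies in the domain and \<open>\<Delta>f = w\<close> in
  \<open>L\<^sup>2(\<Omega>)\<close>.\<close>

definition dirichlet_laplacian ::
  "'a::euclidean_space set \<Rightarrow> ('a \<Rightarrow> real) \<Rightarrow> ('a \<Rightarrow> real) \<Rightarrow> bool" where
  "dirichlet_laplacian \<Omega> f w \<longleftrightarrow> f \<in> sobolev_H10 \<Omega> \<inter> sobolev_H2 \<Omega> \<and>
     (\<exists>g h. (\<forall>i\<in>Basis. has_weak_pderiv \<Omega> i f (g i) \<and> has_weak_pderiv \<Omega> i (g i) (h i)) \<and>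
        (AE x in lebesgue_on \<Omega>. w x = (\<Sum>i\<in>Basis. h i x)))"

definition orthonormal_basis :: "'a::euclidean_space set \<Rightarrow> (nat \<Rightarrow> 'a \<Rightarrow> real) \<Rightarrow> bool" where
  "orthonormal_basis \<Omega> \<phi> \<longleftrightarrow> (\<forall>n. \<phi> n \<in> L2 \<Omega>) \<and>
     (\<forall>m n. L2_inner \<Omega> (\<phi> m) (\<phi> n) = (if m = n then 1 else 0)) \<and>
     (\<forall>f\<in>L2 \<Omega>. \<forall>\<epsilon>>0. \<exists>N c. L2_norm \<Omega> (\<lambda>x. f x - (\<Sum>n<N. c n * \<phi> n x)) < \<epsilon>)"

text \<open>The index starts at \<open>0\<close>, so \<open>lam n\<close> and \<open>\<phi> n\<close> stand for the usual \<open>\<lambda>\<^sub>n\<^sub>+\<^sub>1\<close> and \<open>\<phi>\<^sub>n\<^sub>+\<^sub>1\<close>.\<close>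

definition dirichlet_eigensystem ::
  "'a::euclidean_space set \<Rightarrow> (nat \<Rightarrow> real) \<Rightarrow> (nat \<Rightarrow> 'a \<Rightarrow> real) \<Rightarrow> bool" where
  "dirichlet_eigensystem \<Omega> lam \<phi> \<longleftrightarrow> 0 < lam 0 \<and> incseq lam \<and> filterlim lam at_top sequentially \<and>
     orthonormal_basis \<Omega> \<phi> \<and> (\<forall>n. dirichlet_laplacian \<Omega> (\<phi> n) (\<lambda>x. - lam n * \<phi> n x))"

subsection \<open>The direct and the inverse problem\<close>

text \<open>The solution on \<open>[0, T]\<close> of the direct problem
  \<open>\<D>\<^sub>(\<^sub>k\<^sub>) u = \<Delta>u + f(x) q(t)\<close> with zero Dirichlet boundary values and zero initial value is, by
  definition, the eigenfunction expansion converging in \<open>L\<^sup>2(\<Omega>)\<close>. The kernel \<open>k\<close> enters through the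
  impulse response \<open>v t \<mu>\<close> of the relaxation equation with parameter \<open>\<mu>\<close>.\<close>

definition direct_solution ::
  "'a::euclidean_space set \<Rightarrow> (nat \<Rightarrow> real) \<Rightarrow> (nat \<Rightarrow> 'a \<Rightarrow> real) \<Rightarrow> (real \<Rightarrow> real \<Rightarrow> real) \<Rightarrow>
   real \<Rightarrow> (real \<Rightarrow> real) \<Rightarrow> ('a \<Rightarrow> real) \<Rightarrow> ('a \<Rightarrow> real \<Rightarrow> real) \<Rightarrow> bool" where
  "direct_solution \<Omega> lam \<phi> v T q f u \<longleftrightarrow>
     (\<forall>t\<in>{0..T}. (\<lambda>x. u x t) \<in> L2 \<Omega> \<and>
        (\<lambda>N. L2_norm \<Omega> (\<lambda>x. u x t -
           (\<Sum>n<N. L2_inner \<Omega> f (\<phi> n) *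
              (LINT \<tau>:{0<..<t}|lebesgue. v (t - \<tau>) (lam n) * q \<tau>) * \<phi> n x))) \<longlonglongrightarrow> 0)"

definition inverse_source_solution ::
  "'a::euclidean_space set \<Rightarrow> (nat \<Rightarrow> real) \<Rightarrow> (nat \<Rightarrow> 'a \<Rightarrow> real) \<Rightarrow> (real \<Rightarrow> real \<Rightarrow> real) \<Rightarrow>
   real \<Rightarrow> (real \<Rightarrow> real) \<Rightarrow> ('a \<Rightarrow> real) \<Rightarrow> ('a \<Rightarrow> real) \<Rightarrow> ('a \<Rightarrow> real \<Rightarrow> real) \<Rightarrow> bool" where
  "inverse_source_solution \<Omega> lam \<phi> v T q h f u \<longleftrightarrow> f \<in> L2 \<Omega> \<and>
     direct_solution \<Omega> lam \<phi> v T q f u \<and> (AE x in lebesgue_on \<Omega>. u x T = h x)"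

end

theory Submission imports Defs
begin

text \<open>
  Write \<open>L k\<close> for the Laplace transform of \<open>k\<close>. Projecting the eigenfunction expansion
  of \<open>u(\<cdot>, T) = h\<close> onto \<open>\<phi>\<^sub>n\<close> gives \<open>(h, \<phi>\<^sub>n) = (f, \<phi>\<^sub>n) c\<^sub>n\<close> with
  \<open>c\<^sub>n = \<integral>\<^sub>0\<^sup>T v(T - \<tau>; \<lambda>\<^sub>n) q(\<tau>) d\<tau>\<close>. If every \<open>c\<^sub>n\<close> is positive, then \<open>h\<close> determines all coefficients
  of \<open>f\<close>, hence \<open>f\<close>, and then the expansion determines \<open>u\<close>. So everything rests on
  \<open>c\<^sub>n > 0\<close> (\<open>impulse_response_convolution_pos\<close>), and since \<open>q > 0\<close> it suffices that the impulse
  response is nonnegative on \<open>(0, \<infinity>)\<close> and does not vanish identically on \<open>(0, T)\<close>.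

  Only the Laplace transform \<open>F(s) = 1 / (s L k(s) + \<lambda>)\<close> of the impulse response is known, so its sign
  must be read off \<open>F\<close>. Instead of derivatives of \<open>F\<close>, the proof uses only the values \<open>F(1), F(2), \<dots>\<close>
  and their iterated differences. Under the substitution \<open>x = e\<^sup>-\<^sup>t\<close> these values are the Hausdorff
  moments of a density on \<open>(0, 1)\<close>, and their iterated differences are its integrals against
  \<open>x\<^sup>n (1 - x)\<^sup>m\<close>, that is, against Bernstein polynomials up to positive factors. If the differences are
  nonnegative, Weierstrass approximation makes the integral against every nonnegative continuous
  function nonnegative, and so the impulse response is nonnegative (\<open>nonneg_if_cm_laplace\<close>).

  The differences of \<open>F\<close> are nonnegative because \<open>s L k(s) + \<lambda>\<close> is positive and has a completely monotone
  difference sequence, which makes its reciprocal completely monotone (\<open>cm_seq_inverse\<close>). For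
  the difference sequence, a Stieltjes function is \<open>a / s + b\<close> plus the transform of a nonincreasing
  \<open>\<psi>\<close>, and the iterated differences of \<open>s L \<psi>(s)\<close> are integrals \<open>\<integral> \<psi> P'\<close> with
  \<open>P \<ge> 0\<close> rising from \<open>0\<close> to one peak and falling back to \<open>0\<close>; they are nonnegative because \<open>\<psi>\<close> gives
  the rising part the larger weight (\<open>laplace_nonincreasing_cm_seq\<close>).

  Finally, a nonnegative function that vanishes on \<open>(0, T)\<close> has a transform of order \<open>e\<^sup>-\<^sup>s\<^sup>T\<close>, whereas
  \<open>L k(s) \<rightarrow> 0\<close> forces \<open>F(s) \<ge> 1 / (s + \<lambda>)\<close> for large \<open>s\<close> (\<open>positive_near_zero\<close>).
\<close>

section \<open>Completely monotone sequences\<close>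

text \<open>
  Complete monotonicity of a sequence, cut off at differences of order \<open>m\<close>. The cut-off makes the
  reciprocal of a sequence accessible to induction: its differences of order \<open>m + 1\<close> are expressed
  through its own differences of order at most \<open>m\<close>.
\<close>

primrec cm_seq :: "nat \<Rightarrow> (nat \<Rightarrow> real) \<Rightarrow> bool" where
  "cm_seq 0 a \<longleftrightarrow> (\<forall>n. 0 \<le> a n)"
| "cm_seq (Suc m) a \<longleftrightarrow> (\<forall>n. 0 \<le> a n) \<and> cm_seq m (\<lambda>n. a n - a (Suc n))"

lemma cm_seq_nonneg: "cm_seq m a \<Longrightarrow> 0 \<le> a n"
  by (cases m) auto

lemma cm_seq_weaken: "cm_seq (Suc m) a \<Longrightarrow> cm_seq m a"
proof (induction m arbitrary: a)
  case (Suc m)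
  then have "cm_seq m (\<lambda>n. a n - a (Suc n))"
    by (simp only: cm_seq.simps(2)[of "Suc m"])
  then show ?case using Suc.prems by simp
qed simp

lemma cm_seq_shift: "cm_seq m a \<Longrightarrow> cm_seq m (\<lambda>n. a (Suc n))"
proof (induction m arbitrary: a)
  case (Suc m)
  have "cm_seq m (\<lambda>n. a (Suc n) - a (Suc (Suc n)))"
    using Suc.prems by (intro Suc.IH) simp
  then show ?case using Suc.prems by simp
qed simp

lemma cm_seq_add: "cm_seq m a \<Longrightarrow> cm_seq m b \<Longrightarrow> cm_seq m (\<lambda>n. a n + b n)"
proof (induction m arbitrary: a b)
  case (Suc m)
  have "cm_seq m (\<lambda>n. (a n - a (Suc n)) + (b n - b (Suc n)))"
    using Suc.prems by (intro Suc.IH) auto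
  also have "(\<lambda>n. (a n - a (Suc n)) + (b n - b (Suc n))) = (\<lambda>n. a n + b n - (a (Suc n) + b (Suc n)))"
    by auto
  finally show ?case using Suc.prems by simp
qed simp

lemma cm_seq_const: "0 \<le> c \<Longrightarrow> cm_seq m (\<lambda>n. c)"
proof (induction m arbitrary: c)
  case (Suc m)
  then have "cm_seq m (\<lambda>n. 0)" by blast
  with Suc.prems show ?case by simp
qed simp

text \<open>
  The discrete Leibniz rule for \<open>\<nabla>a\<^sub>n = a\<^sub>n - a\<^sub>n\<^sub>+\<^sub>1\<close> is \<open>\<nabla>(a b)\<^sub>n = \<nabla>a\<^sub>n b\<^sub>n + a\<^sub>n\<^sub>+\<^sub>1 \<nabla>b\<^sub>n\<close>; both summands are
  products of sequences that are completely monotone up to one order less.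
\<close>

lemma cm_seq_mult: "cm_seq m a \<Longrightarrow> cm_seq m b \<Longrightarrow> cm_seq m (\<lambda>n. a n * b n)"
proof (induction m arbitrary: a b)
  case (Suc m)
  define a' where "a' = (\<lambda>n. a n - a (Suc n))"
  define b' where "b' = (\<lambda>n. b n - b (Suc n))"
  have *: "cm_seq m a" "cm_seq m b" "cm_seq m a'" "cm_seq m b'"
    using Suc.prems Suc.prems[THEN cm_seq_weaken] by (simp_all add: a'_def b'_def)
  have "cm_seq m (\<lambda>n. a' n * b n + a (Suc n) * b' n)"
    by (intro cm_seq_add Suc.IH cm_seq_shift *)
  also have "(\<lambda>n. a' n * b n + a (Suc n) * b' n) = (\<lambda>n. a n * b n - a (Suc n) * b (Suc n))"
    by (auto simp: a'_def b'_def algebra_simps)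
  finally show ?case using cm_seq_nonneg[OF Suc.prems(1)] cm_seq_nonneg[OF Suc.prems(2)]
    by simp
qed simp

text \<open>
  This is the discrete form of the fact that the reciprocal of a Bernstein function is completely
  monotone: \<open>1/G\<^sub>n - 1/G\<^sub>n\<^sub>+\<^sub>1 = (1/G\<^sub>n) (1/G\<^sub>n\<^sub>+\<^sub>1) (G\<^sub>n\<^sub>+\<^sub>1 - G\<^sub>n)\<close> expresses the differences of \<open>1/G\<close> as a product
  whose factors are already under control at the preceding order.
\<close>

lemma cm_seq_inverse:
  assumes pos: "\<And>n. 0 < G n" and D: "\<And>m. cm_seq m (\<lambda>n. G (Suc n) - G n)"
  shows "cm_seq m (\<lambda>n. 1 / G n)"
proof (induction m)
  case 0
  then show ?case using pos by (simp add: less_imp_le)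
next
  case (Suc m)
  have "cm_seq m (\<lambda>n. 1 / G n * (1 / G (Suc n)) * (G (Suc n) - G n))"
    by (intro cm_seq_mult cm_seq_shift[of m "\<lambda>n. 1 / G n"] Suc.IH D)
  also have "(\<lambda>n. 1 / G n * (1 / G (Suc n)) * (G (Suc n) - G n)) = (\<lambda>n. 1 / G n - 1 / G (Suc n))"
  proof
    fix n show "1 / G n * (1 / G (Suc n)) * (G (Suc n) - G n) = 1 / G n - 1 / G (Suc n)"
      using pos[of n] pos[of "Suc n"] by (simp add: field_simps)
  qed
  finally show ?case using pos by (simp add: less_imp_le)
qed

text \<open>
  The iterated differences of a sequence of integrals are again integrals, arranged in such an array
  \<open>J\<close>. The equivalence is used in both directions: to obtain complete monotonicity from the sign of
  the integrals, and to recover the sign of the integrals from it.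
\<close>

lemma cm_seq_array_iff:
  assumes J: "\<And>m n. J (Suc m) n = J m n - J m (Suc n)"
  shows "(\<forall>m. cm_seq m (J 0)) \<longleftrightarrow> (\<forall>m n. 0 \<le> J m n)"
proof -
  have J': "(\<lambda>n. J i n - J i (Suc n)) = J (Suc i)" for i
    by (rule ext) (rule J[symmetric])
  show ?thesis
  proof
    assume L: "\<forall>m. cm_seq m (J 0)"
    have "\<forall>m. cm_seq m (J i)" for i
    proof (induction i)
      case (Suc i)
      then have "cm_seq (Suc m) (J i)" for m by blast
      then have "cm_seq m (\<lambda>n. J i n - J i (Suc n))" for m by simp
      then show ?case by (simp only: J') simp
    qed (use L in simp)
    then show "\<forall>m n. 0 \<le> J m n" using cm_seq_nonneg by blast
  next
    assume R: "\<forall>m n. 0 \<le> J m n"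
    have "cm_seq m (J i)" for m i
    proof (induction m arbitrary: i)
      case (Suc m)
      show ?case using R Suc.IH[of "Suc i"] by (simp add: J')
    qed (use R in simp)
    then show "\<forall>m. cm_seq m (J 0)" by blast
  qed
qed

section \<open>Differences of Laplace transforms\<close>

text \<open>
  The derivative of \<open>P(t) = e\<^sup>-\<^sup>(\<^sup>n\<^sup>+\<^sup>1\<^sup>)\<^sup>t (1 - e\<^sup>-\<^sup>t)\<^sup>m\<^sup>+\<^sup>1\<close>, with the factor that carries its sign written last. For
  \<open>m = 0\<close> it equals \<open>(n + 2) e\<^sup>-\<^sup>(\<^sup>n\<^sup>+\<^sup>2\<^sup>)\<^sup>t - (n + 1) e\<^sup>-\<^sup>(\<^sup>n\<^sup>+\<^sup>1\<^sup>)\<^sup>t\<close>, the kernel of the first difference of \<open>s L \<psi>(s)\<close> at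
  \<open>s = n + 1\<close>.
\<close>

definition profile_deriv :: "nat \<Rightarrow> nat \<Rightarrow> real \<Rightarrow> real" where
  "profile_deriv m n t = exp (- ((1 + real n) * t)) * (1 - exp (- t)) ^ m *
     ((real n + real m + 2) * exp (- t) - (real n + 1))"

lemma exp_step: "exp (- ((1 + real (Suc n)) * t)) = exp (- ((1 + real n) * t)) * exp (- t)"
  unfolding exp_add[symmetric] by (simp add: algebra_simps)

lemma profile_deriv_Suc:
  "profile_deriv (Suc m) n t = profile_deriv m n t - profile_deriv m (Suc n) t"
  unfolding profile_deriv_def exp_step by (simp add: algebra_simps)

lemma profile_deriv_0:
  "profile_deriv 0 n t = (2 + real n) * exp (- ((1 + real (Suc n)) * t)) - (1 + real n) * exp (- ((1 + real n) * t))"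
  unfolding profile_deriv_def exp_step by (simp add: algebra_simps)

lemma integral_profile_deriv:
  assumes L: "\<And>s. 0 < s \<Longrightarrow> laplace_exists \<psi> s"
  defines "J \<equiv> \<lambda>m n. LINT t:{0<..}|lebesgue. profile_deriv m n t * \<psi> t"
  shows "set_integrable lebesgue {0<..} (\<lambda>t. profile_deriv m n t * \<psi> t)"
    and "J (Suc m) n = J m n - J m (Suc n)"
    and "J 0 n = (2 + real n) * laplace \<psi> (2 + real n) - (1 + real n) * laplace \<psi> (1 + real n)"
proof -
  have L': "set_integrable lebesgue {0<..} (\<lambda>t. exp (- ((1 + real n) * t)) * \<psi> t)" for n
    using L[of "1 + real n"] by (simp add: laplace_exists_def)
  have eq0: "(\<lambda>t. profile_deriv 0 n t * \<psi> t) = (\<lambda>t. (2 + real n) * (exp (- ((1 + real (Suc n)) * t)) * \<psi> t)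
      - (1 + real n) * (exp (- ((1 + real n) * t)) * \<psi> t))" for n
    unfolding profile_deriv_0 by (auto simp: algebra_simps)
  have eqS: "(\<lambda>t. profile_deriv (Suc m) n t * \<psi> t) =
      (\<lambda>t. profile_deriv m n t * \<psi> t - profile_deriv m (Suc n) t * \<psi> t)" for m n
    unfolding profile_deriv_Suc by (auto simp: algebra_simps)
  have int: "set_integrable lebesgue {0<..} (\<lambda>t. profile_deriv m n t * \<psi> t)" for m n
  proof (induction m arbitrary: n)
    case 0
    show ?case unfolding eq0 by (intro set_integral_diff set_integrable_mult_right L')
  next
    case (Suc m)
    show ?case unfolding eqS by (intro set_integral_diff Suc)
  qed
  show "set_integrable lebesgue {0<..} (\<lambda>t. profile_deriv m n t * \<psi> t)" by (rule int)
  show "J (Suc m) n = J m n - J m (Suc n)"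
    unfolding J_def eqS by (intro set_integral_diff int)
  have "J 0 n = (LINT t:{0<..}|lebesgue. (2 + real n) * (exp (- ((1 + real (Suc n)) * t)) * \<psi> t))
      - (LINT t:{0<..}|lebesgue. (1 + real n) * (exp (- ((1 + real n) * t)) * \<psi> t))"
    unfolding J_def eq0 by (intro set_integral_diff set_integrable_mult_right L')
  then show "J 0 n = (2 + real n) * laplace \<psi> (2 + real n) - (1 + real n) * laplace \<psi> (1 + real n)"
    by (simp add: laplace_def add.commute)
qed

lemma laplace_one:
  assumes "0 < s"
  shows "laplace_exists (\<lambda>_. 1) s" "laplace (\<lambda>_. 1) s = 1 / s"
proof -
  have hi: "((\<lambda>t. exp (- s * t)) has_integral exp (- s * 0) / s) {0..}"
    using has_integral_exp_minus_to_infinity[OF assms, of 0] by simp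
  have hi': "((\<lambda>t. exp (- (s * t))) has_integral 1 / s) {0<..}"
  proof -
    have "{t \<in> {0..} - {0<..}. exp (- s * t) \<noteq> 0} \<subseteq> {0::real}"
      and e: "{t \<in> {0<..} - {0..}. exp (- s * t) \<noteq> 0} = ({}::real set)" by auto
    then have "negligible {t \<in> {0..} - {0<..}. exp (- s * t) \<noteq> 0}"
      using negligible_subset[OF negligible_sing] by blast
    then have "((\<lambda>t. exp (- s * t)) has_integral 1 / s) {0<..}"
      using hi has_integral_spike_set_eq[of "{0..}" "{0<..}" "\<lambda>t. exp (- s * t)" "1 / s"] e
      by (simp only: negligible_empty simp_thms exp_zero mult_zero_right)
    then show ?thesis by simp
  qed
  have "(\<lambda>t. exp (- (s * t))) absolutely_integrable_on {0<..}"
    using hi' by (intro nonnegative_absolutely_integrable_1) auto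
  then show "laplace_exists (\<lambda>_. 1) s" "laplace (\<lambda>_. 1) s = 1 / s"
    using set_lebesgue_integral_eq_integral(2)[of "{0<..}" "\<lambda>t. exp (- (s * t))"] hi'
    by (auto simp: laplace_exists_def laplace_def integral_unique)
qed

text \<open>
  The antiderivative \<open>P\<close> vanishes at \<open>0\<close> and at infinity. The fundamental theorem of calculus is avoided by noting that the
  integrals are iterated differences of \<open>s L 1(s)\<close>, which is constantly \<open>1\<close>.
\<close>

lemma integral_profile_deriv_zero: "(LINT t:{0<..}|lebesgue. profile_deriv m n t) = 0"
proof (induction m arbitrary: n)
  case 0
  show ?case using integral_profile_deriv(3)[of "\<lambda>_. 1" n] laplace_one by simp
next
  case (Suc m)
  then show ?case using integral_profile_deriv(2)[of "\<lambda>_. 1" m n] laplace_one by simp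
qed

text \<open>
  The weight \<open>P' = profile_deriv m n\<close> is positive before its only zero \<open>z\<close> and negative after it, so
  \<open>\<psi> P' \<ge> \<psi>(z) P'\<close> pointwise for nonincreasing \<open>\<psi>\<close>. The right-hand side has integral zero.
\<close>

lemma laplace_nonincreasing_cm_seq:
  assumes L: "\<And>s. 0 < s \<Longrightarrow> laplace_exists \<psi> s"
    and anti: "\<And>s t. 0 < s \<Longrightarrow> s \<le> t \<Longrightarrow> \<psi> t \<le> \<psi> s"
  shows "cm_seq m (\<lambda>n. (2 + real n) * laplace \<psi> (2 + real n) - (1 + real n) * laplace \<psi> (1 + real n))"
proof -
  define J where "J = (\<lambda>m n. LINT t:{0<..}|lebesgue. profile_deriv m n t * \<psi> t)"
  have "0 \<le> J m n" for m n
  proof -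
    \<comment> \<open>the value of \<open>e\<^sup>-\<^sup>t\<close> at which \<open>profile_deriv m n t\<close> changes sign\<close>
    define r where "r = (real n + 1) / (real n + real m + 2)"
    define z where "z = - ln r"
    have r: "0 < r" "r < 1" by (auto simp: r_def)
    then have z: "0 < z" "exp (- z) = r" by (auto simp: z_def)
    have i1: "set_integrable lebesgue {0<..} (\<lambda>t. \<psi> z * profile_deriv m n t)"
      using integral_profile_deriv(1)[of "\<lambda>_. 1" m n] laplace_one by simp
    have "0 = (LINT t:{0<..}|lebesgue. \<psi> z * profile_deriv m n t)"
      by (simp add: integral_profile_deriv_zero)
    also have "\<dots> \<le> J m n"
      unfolding J_def
    proof (rule set_integral_mono[OF i1 integral_profile_deriv(1)[OF L]])
      fix t :: real assume t: "t \<in> {0<..}"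
      have sg: "profile_deriv m n t =
          exp (- ((1 + real n) * t)) * (1 - exp (- t)) ^ m * (real n + real m + 2) * (exp (- t) - r)"
        unfolding profile_deriv_def r_def by (simp add: field_simps)
      have c: "0 \<le> exp (- ((1 + real n) * t)) * (1 - exp (- t)) ^ m * (real n + real m + 2)" (is "0 \<le> ?c")
        using t by (intro mult_nonneg_nonneg) auto
      have "0 \<le> (exp (- t) - r) * (\<psi> t - \<psi> z)"
      proof (cases "t \<le> z")
        case True
        then have "r \<le> exp (- t)" using z by (metis exp_le_cancel_iff neg_le_iff_le)
        then show ?thesis using anti[of t z] t True by simp
      next
        case False
        then have "exp (- t) \<le> r" using z by (metis exp_le_cancel_iff neg_le_iff_le linear)
        then show ?thesis using anti[of z t] z False by (simp add: mult_nonpos_nonpos)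
      qed
      then have "0 \<le> ?c * ((exp (- t) - r) * (\<psi> t - \<psi> z))" using c by (rule mult_nonneg_nonneg[rotated])
      then show "\<psi> z * profile_deriv m n t \<le> profile_deriv m n t * \<psi> t"
        unfolding sg by (simp add: algebra_simps)
    qed auto
    finally show ?thesis .
  qed
  moreover have "J (Suc m) n = J m n - J m (Suc n)" for m n
    unfolding J_def by (rule integral_profile_deriv(2)[OF L])
  ultimately have "cm_seq m (J 0)" using cm_seq_array_iff[of J] by blast
  moreover have "J 0 = (\<lambda>n. (2 + real n) * laplace \<psi> (2 + real n) - (1 + real n) * laplace \<psi> (1 + real n))"
    unfolding J_def by (rule ext) (rule integral_profile_deriv(3)[OF L])
  ultimately show ?thesis by (simp only:)
qed

lemma completely_monotone_antimono:
  assumes "completely_monotone \<psi>" "0 < s" "s \<le> t"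
  shows "\<psi> t \<le> \<psi> s"
proof (rule DERIV_nonpos_imp_nonincreasing[OF assms(3)])
  fix x assume "s \<le> x" "x \<le> t"
  then have x: "0 < x" using assms by simp
  have "((deriv ^^ 0) \<psi>) differentiable (at x)" and "0 \<le> (-1) ^ 1 * (deriv ^^ 1) \<psi> x"
    using assms(1) x unfolding completely_monotone_def by blast+
  then have "DERIV \<psi> x :> deriv \<psi> x" "deriv \<psi> x \<le> 0"
    by (auto simp: DERIV_deriv_iff_real_differentiable)
  then show "\<exists>y. DERIV \<psi> x :> y \<and> y \<le> 0" by blast
qed

text \<open>
  In \<open>s \<kappa>(s) = a + b s + s L \<psi>(s)\<close> the first two terms contribute only the constant \<open>b\<close> to the first
  differences.
\<close>

lemma relaxation_symbol_cm_seq: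
  assumes "stieltjes_function \<kappa>" and pos: "\<And>s. 0 < s \<Longrightarrow> 0 \<le> \<kappa> s" and \<mu>: "0 < \<mu>"
  shows "cm_seq m (\<lambda>n. 1 / ((1 + real n) * \<kappa> (1 + real n) + \<mu>))"
proof -
  obtain a b \<psi> where ab: "0 \<le> a" "0 \<le> b" and \<psi>: "completely_monotone \<psi>" "\<And>s. 0 < s \<Longrightarrow> laplace_exists \<psi> s"
    and \<kappa>: "\<And>s. 0 < s \<Longrightarrow> \<kappa> s = a / s + b + laplace \<psi> s"
    using assms(1) unfolding stieltjes_function_def by blast
  define G where "G = (\<lambda>n::nat. (1 + real n) * \<kappa> (1 + real n) + \<mu>)"
  have "0 < G n" for n
    unfolding G_def using pos[of "1 + real n"] \<mu> by (simp add: add_nonneg_pos)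
  moreover have "cm_seq m (\<lambda>n. G (Suc n) - G n)" for m
  proof -
    have "cm_seq m (\<lambda>n. b + ((2 + real n) * laplace \<psi> (2 + real n) - (1 + real n) * laplace \<psi> (1 + real n)))"
      by (intro cm_seq_add cm_seq_const ab laplace_nonincreasing_cm_seq \<psi> completely_monotone_antimono[OF \<psi>(1)])
    moreover have "(\<lambda>n. b + ((2 + real n) * laplace \<psi> (2 + real n) - (1 + real n) * laplace \<psi> (1 + real n)))
        = (\<lambda>n. G (Suc n) - G n)"
      using \<kappa> by (auto simp: G_def field_simps)
    ultimately show ?thesis by simp
  qed
  ultimately have "cm_seq m (\<lambda>n. 1 / G n)" by (rule cm_seq_inverse)
  then show ?thesis by (simp only: G_def)
qed

section \<open>Functions whose Laplace transform is completely monotone on the positive integers\<close>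

lemma set_integral_pos_interval:
  fixes f :: "real \<Rightarrow> real"
  assumes f: "set_integrable lebesgue A f" and nonneg: "\<And>t. t \<in> A \<Longrightarrow> 0 \<le> f t"
    and ab: "a < b" "{a<..<b} \<subseteq> A" and pos: "\<And>t. t \<in> {a<..<b} \<Longrightarrow> 0 < f t"
  shows "0 < (LINT t:A|lebesgue. f t)"
proof -
  have int: "integrable lebesgue (\<lambda>t. indicator A t *\<^sub>R f t)"
    using f by (simp add: set_integrable_def)
  have nn: "0 \<le> indicator A t *\<^sub>R f t" for t
    using nonneg by (simp add: indicator_def)
  have "0 \<le> (LINT t:A|lebesgue. f t)"
    unfolding set_lebesgue_integral_def using nn by (rule Bochner_Integration.integral_nonneg)
  moreover have "(LINT t:A|lebesgue. f t) \<noteq> 0"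
  proof
    assume "(LINT t:A|lebesgue. f t) = 0"
    then have "AE t in lebesgue. indicator A t *\<^sub>R f t = 0"
      unfolding set_lebesgue_integral_def using integral_nonneg_eq_0_iff_AE[OF int] nn by blast
    then have "AE t in lebesgue. t \<notin> {a<..<b}"
    proof (rule AE_mp, intro AE_I2 impI notI)
      fix t assume "indicator A t *\<^sub>R f t = 0" "t \<in> {a<..<b}"
      then show False using pos[of t] ab(2) by (auto simp: indicator_def)
    qed
    then have "{a<..<b} \<in> null_sets lebesgue"
      by (subst AE_iff_null_sets) auto
    then have "emeasure lborel {a<..<b} = 0" by (auto simp: null_sets_def)
    then show False using ab(1) by simp
  qed
  ultimately show ?thesis by simp
qed

lemma set_borel_measurable_lebesgue_continuous:
  fixes f :: "real \<Rightarrow> real"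
  assumes "A \<in> sets borel" "continuous_on A f"
  shows "set_borel_measurable lebesgue A f"
proof -
  have "(\<lambda>x. indicator A x *\<^sub>R f x) \<in> borel_measurable lborel"
    using borel_measurable_continuous_on_indicator[OF assms] by simp
  then show ?thesis unfolding set_borel_measurable_def by (rule measurable_completion)
qed

context
  fixes w :: "real \<Rightarrow> real"
  assumes w_cont: "continuous_on {0<..} w"
    and w_laplace: "\<And>s. 0 < s \<Longrightarrow> laplace_exists w s"
begin

lemma continuous_weight_integrable:
  assumes p: "continuous_on {0..1} p"
  shows "set_integrable lebesgue {0<..} (\<lambda>t. p (exp (- t)) * (exp (- t) * w t))"
proof -
  obtain C where C: "\<And>x. x \<in> {0..1} \<Longrightarrow> \<bar>p x\<bar> \<le> C"
    using compact_imp_bounded[OF compact_continuous_image[OF p compact_Icc]]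
    unfolding bounded_iff by (metis imageI real_norm_def)
  have g: "set_integrable lebesgue {0<..} (\<lambda>t. C * (exp (- t) * w t))"
    using w_laplace[of 1] by (intro set_integrable_mult_right) (simp add: laplace_exists_def)
  have "continuous_on {0<..} (\<lambda>t. p (exp (- t)) * (exp (- t) * w t))"
    by (intro continuous_intros w_cont continuous_on_compose2[OF p]) auto
  then have "set_borel_measurable lebesgue {0<..} (\<lambda>t. p (exp (- t)) * (exp (- t) * w t))"
    by (intro set_borel_measurable_lebesgue_continuous) auto
  then show ?thesis
  proof (rule set_integrable_bound[OF g], intro AE_I2 impI)
    fix t :: real assume "t \<in> {0<..}"
    then have "\<bar>p (exp (- t))\<bar> \<le> \<bar>C\<bar>" using C[of "exp (- t)"] by auto
    then show "norm (p (exp (- t)) * (exp (- t) * w t)) \<le> norm (C * (exp (- t) * w t))"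
      by (auto simp: abs_mult intro!: mult_right_mono)
  qed
qed

text \<open>
  With \<open>x = e\<^sup>-\<^sup>t\<close>, the integrals of \<open>x\<^sup>n (1 - x)\<^sup>m\<close> against \<open>e\<^sup>-\<^sup>t w(t)\<close> are the iterated differences of
  \<open>n \<mapsto> L w(1 + n)\<close>, because \<open>x\<^sup>n (1 - x)\<^sup>m (1 - x) = x\<^sup>n (1 - x)\<^sup>m - x\<^sup>n\<^sup>+\<^sup>1 (1 - x)\<^sup>m\<close>.
\<close>

lemma bernstein_moment_nonneg:
  assumes cm: "\<And>m. cm_seq m (\<lambda>n. laplace w (1 + real n))"
  shows "0 \<le> (LINT t:{0<..}|lebesgue. Bernstein N k (exp (- t)) * (exp (- t) * w t))"
proof -
  define J where "J = (\<lambda>m n. LINT t:{0<..}|lebesgue. (exp (- t) ^ n * (1 - exp (- t)) ^ m) * (exp (- t) * w t))"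
  have int: "set_integrable lebesgue {0<..} (\<lambda>t. (exp (- t) ^ n * (1 - exp (- t)) ^ m) * (exp (- t) * w t))" for m n
    by (rule continuous_weight_integrable) (intro continuous_intros)
  have "J (Suc m) n = J m n - J m (Suc n)" for m n
  proof -
    have "J (Suc m) n = (LINT t:{0<..}|lebesgue. (exp (- t) ^ n * (1 - exp (- t)) ^ m) * (exp (- t) * w t)
        - (exp (- t) ^ Suc n * (1 - exp (- t)) ^ m) * (exp (- t) * w t))"
      unfolding J_def by (intro arg_cong[where f = "set_lebesgue_integral lebesgue {0<..}"] ext)
        (simp add: algebra_simps)
    then show ?thesis unfolding J_def by (simp only: set_integral_diff(2)[OF int int])
  qed
  moreover have "J 0 = (\<lambda>n. laplace w (1 + real n))"
  proof
    fix n
    have "exp (- ((1 + real n) * t)) * w t = (exp (- t) ^ n * (1 - exp (- t)) ^ 0) * (exp (- t) * w t)" for t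
      unfolding exp_of_nat_mult[symmetric]
      by (simp add: algebra_simps flip: exp_add)
    then show "J 0 n = laplace w (1 + real n)"
      unfolding J_def laplace_def by (simp only:)
  qed
  ultimately have J: "0 \<le> J m n" for m n
    using cm_seq_array_iff[of J] cm by simp
  have "(LINT t:{0<..}|lebesgue. Bernstein N k (exp (- t)) * (exp (- t) * w t)) = real (N choose k) * J (N - k) k"
    unfolding J_def Bernstein_def set_integral_mult_right[symmetric] by (simp only: mult.assoc)
  then show ?thesis using J[of "N - k" k] by simp
qed

text \<open>
  The Bernstein polynomials of \<open>p \<ge> 0\<close> have nonnegative coefficients with respect to the Bernstein
  basis and converge uniformly to \<open>p\<close>; the error of the integral is controlled by the integral of
  \<open>\<bar>e\<^sup>-\<^sup>t w(t)\<bar>\<close>.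
\<close>

lemma weighted_integral_nonneg:
  assumes cm: "\<And>m. cm_seq m (\<lambda>n. laplace w (1 + real n))"
    and p: "continuous_on {0..1} p" and p0: "\<And>x. x \<in> {0..1} \<Longrightarrow> 0 \<le> p x"
  shows "0 \<le> (LINT t:{0<..}|lebesgue. p (exp (- t)) * (exp (- t) * w t))" (is "0 \<le> ?I")
proof (rule ccontr)
  assume neg: "\<not> 0 \<le> ?I"
  have g: "set_integrable lebesgue {0<..} (\<lambda>t. \<bar>exp (- t) * w t\<bar>)"
    using w_laplace[of 1] by (intro set_integrable_abs) (simp add: laplace_exists_def)
  define A where "A = (LINT t:{0<..}|lebesgue. \<bar>exp (- t) * w t\<bar>)"
  have A: "0 \<le> A" unfolding A_def set_lebesgue_integral_def by (intro Bochner_Integration.integral_nonneg) simp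
  \<comment> \<open>so small that the approximation error \<open>\<epsilon> A\<close> is less than \<open>- ?I\<close>; the summand \<open>1\<close> covers \<open>A = 0\<close>\<close>
  define \<epsilon> where "\<epsilon> = - ?I / (A + 1)"
  have \<epsilon>: "0 < \<epsilon>" using neg A unfolding \<epsilon>_def by (intro divide_pos_pos) auto
  obtain N where N: "\<And>x. x \<in> {0..1} \<Longrightarrow> \<bar>p x - (\<Sum>k\<le>N. p (k / N) * Bernstein N k x)\<bar> < \<epsilon>"
    using Bernstein_Weierstrass[OF p \<epsilon>] by blast
  define B where "B = (\<lambda>x. \<Sum>k\<le>N. p (k / N) * Bernstein N k x)"
  have B_cont: "continuous_on {0..1} B"
    unfolding B_def Bernstein_def by (intro continuous_intros)
  note B_int = continuous_weight_integrable[OF B_cont]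
  have kint: "set_integrable lebesgue {0<..} (\<lambda>t. p (k / N) * (Bernstein N k (exp (- t)) * (exp (- t) * w t)))" for k
    unfolding Bernstein_def
    by (intro set_integrable_mult_right continuous_weight_integrable continuous_intros)
  have "(LINT t:{0<..}|lebesgue. B (exp (- t)) * (exp (- t) * w t))
      = (LINT t:{0<..}|lebesgue. (\<Sum>k\<le>N. p (k / N) * (Bernstein N k (exp (- t)) * (exp (- t) * w t))))"
    unfolding B_def by (simp only: sum_distrib_right mult.assoc)
  also have "\<dots> = (\<Sum>k\<le>N. LINT t:{0<..}|lebesgue. p (k / N) * (Bernstein N k (exp (- t)) * (exp (- t) * w t)))"
    using kint unfolding set_lebesgue_integral_def set_integrable_def scaleR_sum_right
    by (intro Bochner_Integration.integral_sum) auto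
  also have "\<dots> \<ge> 0"
    unfolding set_integral_mult_right
    by (intro sum_nonneg mult_nonneg_nonneg p0 bernstein_moment_nonneg cm) (auto simp: divide_le_eq_1)
  finally have 1: "0 \<le> (LINT t:{0<..}|lebesgue. B (exp (- t)) * (exp (- t) * w t))" .
  have "(LINT t:{0<..}|lebesgue. B (exp (- t)) * (exp (- t) * w t) - \<epsilon> * \<bar>exp (- t) * w t\<bar>) \<le> ?I"
  proof (rule set_integral_mono)
    show "set_integrable lebesgue {0<..} (\<lambda>t. B (exp (- t)) * (exp (- t) * w t) - \<epsilon> * \<bar>exp (- t) * w t\<bar>)"
      by (intro set_integral_diff set_integrable_mult_right B_int g)
    show "set_integrable lebesgue {0<..} (\<lambda>t. p (exp (- t)) * (exp (- t) * w t))"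
      by (rule continuous_weight_integrable[OF p])
    fix t :: real assume "t \<in> {0<..}"
    then have "\<bar>p (exp (- t)) - B (exp (- t))\<bar> \<le> \<epsilon>"
      using N[of "exp (- t)"] by (simp add: B_def)
    then have "\<bar>(p (exp (- t)) - B (exp (- t))) * (exp (- t) * w t)\<bar> \<le> \<epsilon> * \<bar>exp (- t) * w t\<bar>"
      unfolding abs_mult[of "p (exp (- t)) - B (exp (- t))"] by (rule mult_right_mono) simp
    then show "B (exp (- t)) * (exp (- t) * w t) - \<epsilon> * \<bar>exp (- t) * w t\<bar> \<le> p (exp (- t)) * (exp (- t) * w t)"
      unfolding left_diff_distrib by linarith
  qed
  moreover have "(LINT t:{0<..}|lebesgue. B (exp (- t)) * (exp (- t) * w t) - \<epsilon> * \<bar>exp (- t) * w t\<bar>)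
      = (LINT t:{0<..}|lebesgue. B (exp (- t)) * (exp (- t) * w t)) - \<epsilon> * A"
    unfolding A_def set_integral_mult_right[symmetric]
    by (intro set_integral_diff set_integrable_mult_right B_int g)
  ultimately have "- (\<epsilon> * A) \<le> ?I" using 1 by linarith
  moreover have "\<epsilon> * (A + 1) = - ?I" unfolding \<epsilon>_def using A by (intro nonzero_eq_divide_eq[THEN iffD1]) auto
  ultimately show False using \<epsilon> unfolding distrib_left by linarith
qed

text \<open>
  The positivity part of Bernstein's theorem, with discrete data. At a point where \<open>w\<close> is negative,
  a bump function supported nearby would make the integral of \<open>weighted_integral_nonneg\<close> negative.
\<close>

lemma nonneg_if_cm_laplace:
  assumes cm: "\<And>m. cm_seq m (\<lambda>n. laplace w (1 + real n))" and t0: "0 < t0"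
  shows "0 \<le> w t0"
proof (rule ccontr)
  assume "\<not> 0 \<le> w t0"
  then have "t0 \<in> {0<..} \<inter> w -` {..<0}" using t0 by auto
  moreover have "open ({0<..} \<inter> w -` {..<0})"
    using w_cont by (intro continuous_open_preimage) auto
  ultimately obtain d where d: "0 < d" "\<And>t. t \<in> ball t0 d \<Longrightarrow> 0 < t \<and> w t < 0"
    unfolding open_contains_ball by blast
  have ball: "t \<in> ball t0 d \<longleftrightarrow> t \<in> {t0 - d<..<t0 + d}" for t
    by (auto simp: dist_real_def)
  \<comment> \<open>positive at \<open>e\<^sup>-\<^sup>t\<close> exactly when \<open>\<bar>t - t0\<bar> < d\<close>\<close>
  define p where "p = (\<lambda>x. max 0 ((x - exp (- (t0 + d))) * (exp (- (t0 - d)) - x)))"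
  have p_cont: "continuous_on {0..1} p" unfolding p_def by (intro continuous_intros)
  have p0: "0 \<le> p x" for x by (simp add: p_def)
  have in_ball: "0 < p (exp (- t)) \<longleftrightarrow> t \<in> {t0 - d<..<t0 + d}" for t
    unfolding p_def less_max_iff_disj zero_less_mult_iff using d(1) by auto
  have "0 < (LINT t:{0<..}|lebesgue. - (p (exp (- t)) * (exp (- t) * w t)))"
  proof (rule set_integral_pos_interval[where a = "t0 - d" and b = "t0 + d"])
    show "set_integrable lebesgue {0<..} (\<lambda>t. - (p (exp (- t)) * (exp (- t) * w t)))"
      using set_integrable_mult_right[OF continuous_weight_integrable[OF p_cont], of "-1"] by simp
    show "{t0 - d<..<t0 + d} \<subseteq> {0<..}" using d(2) ball by auto
    show pos: "0 < - (p (exp (- t)) * (exp (- t) * w t))" if "t \<in> {t0 - d<..<t0 + d}" for t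
    proof -
      have "0 < p (exp (- t))" "w t < 0" using that in_ball ball d(2) by blast+
      then show ?thesis by (simp add: mult_pos_neg)
    qed
    show "0 \<le> - (p (exp (- t)) * (exp (- t) * w t))" for t
      using pos[of t] in_ball[of t] p0[of "exp (- t)"]
      by (cases "t \<in> {t0 - d<..<t0 + d}") auto
  qed (use d in auto)
  then show False
    using weighted_integral_nonneg[OF cm p_cont p0]
      set_integral_uminus[OF continuous_weight_integrable[OF p_cont]] by simp
qed

text \<open>
  If \<open>w\<close> vanished on \<open>(0, T)\<close>, then \<open>L w(s) \<le> e\<^sup>-\<^sup>(\<^sup>s\<^sup>-\<^sup>1\<^sup>)\<^sup>T L w(1)\<close> for \<open>s \<ge> 1\<close>, and this exponential decay
  contradicts the algebraic lower bound.
\<close>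

lemma positive_near_zero:
  assumes nonneg: "\<And>t. 0 < t \<Longrightarrow> 0 \<le> w t"
    and lower: "eventually (\<lambda>s. 1 / (s + \<mu>) \<le> laplace w s) at_top" and T: "0 < T"
  shows "\<exists>t\<in>{0<..<T}. 0 < w t"
proof (rule ccontr)
  assume "\<not> ?thesis"
  then have zero: "w t = 0" if "0 < t" "t < T" for t
    using nonneg[of t] that by (auto simp: order_le_less)
  define c where "c = laplace w 1"
  have upper: "laplace w s \<le> exp (- ((s - 1) * T)) * c" if s: "1 \<le> s" for s
    unfolding laplace_def c_def set_integral_mult_right[symmetric]
  proof (rule set_integral_mono)
    show "set_integrable lebesgue {0<..} (\<lambda>t. exp (- (s * t)) * w t)"
      using w_laplace[of s] s by (simp add: laplace_exists_def)
    show "set_integrable lebesgue {0<..} (\<lambda>t. exp (- ((s - 1) * T)) * (exp (- (1 * t)) * w t))"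
      using w_laplace[of 1] by (intro set_integrable_mult_right) (simp add: laplace_exists_def)
    fix t :: real assume t: "t \<in> {0<..}"
    show "exp (- (s * t)) * w t \<le> exp (- ((s - 1) * T)) * (exp (- (1 * t)) * w t)"
    proof (cases "t < T")
      case False
      then have "(s - 1) * T \<le> (s - 1) * t" using s by (intro mult_left_mono) auto
      then have "exp (- (s * t)) \<le> exp (- ((s - 1) * T)) * exp (- (1 * t))"
        unfolding exp_add[symmetric] by (simp add: algebra_simps)
      then have "exp (- (s * t)) * w t \<le> exp (- ((s - 1) * T)) * exp (- (1 * t)) * w t"
        by (rule mult_right_mono) (use nonneg t in simp)
      then show ?thesis by (simp only: mult.assoc)
    qed (use zero t in simp)
  qed
  have lim: "((\<lambda>s. (T * s) ^ k / exp (T * s)) \<longlongrightarrow> 0) at_top" for k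
    by (rule filterlim_compose[OF tendsto_power_div_exp_0])
      (rule filterlim_tendsto_pos_mult_at_top[OF tendsto_const T filterlim_ident])
  have "((\<lambda>s. (c * exp T / T) * ((T * s) ^ 1 / exp (T * s)) + (\<mu> * c * exp T) * ((T * s) ^ 0 / exp (T * s)))
      \<longlongrightarrow> (c * exp T / T) * 0 + (\<mu> * c * exp T) * 0) at_top"
    by (intro tendsto_intros lim)
  moreover have "(c * exp T / T) * ((T * s) ^ 1 / exp (T * s)) + (\<mu> * c * exp T) * ((T * s) ^ 0 / exp (T * s))
      = (s + \<mu>) * (exp (- ((s - 1) * T)) * c)" for s
  proof -
    have "exp (- ((s - 1) * T)) = exp T / exp (T * s)"
      by (simp add: algebra_simps flip: exp_diff)
    then show ?thesis using T by (simp add: field_simps)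
  qed
  ultimately have "((\<lambda>s. (s + \<mu>) * (exp (- ((s - 1) * T)) * c)) \<longlongrightarrow> 0) at_top" by simp
  then have "eventually (\<lambda>s. (s + \<mu>) * (exp (- ((s - 1) * T)) * c) < 1) at_top"
    by (rule order_tendstoD) simp
  moreover have "eventually (\<lambda>s. 1 \<le> s \<and> - \<mu> < s) at_top"
    by (intro eventually_conj eventually_ge_at_top eventually_gt_at_top)
  ultimately have "eventually (\<lambda>s::real. False) at_top"
    using lower
  proof eventually_elim
    case (elim s)
    then have "1 / (s + \<mu>) \<le> exp (- ((s - 1) * T)) * c" "0 < s + \<mu>"
      using upper[of s] by auto
    then have "1 \<le> (s + \<mu>) * (exp (- ((s - 1) * T)) * c)"
      by (simp add: divide_le_eq mult.commute)
    then show False using elim(1) by linarith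
  qed
  then show False by simp
qed

text \<open>
  The integrand is nonnegative and positive on an interval around \<open>T - t\<^sub>0\<close>. Integrability has to be
  established separately: \<open>w\<close> may be unbounded near \<open>0\<close>, and the integral of a nonintegrable function
  is \<open>0\<close> by convention.
\<close>

lemma convolution_pos:
  assumes nonneg: "\<And>t. 0 < t \<Longrightarrow> 0 \<le> w t" and pos: "t\<^sub>0 \<in> {0<..<T}" "0 < w t\<^sub>0"
    and q: "continuous_on {0..T} q" "\<And>t. t \<in> {0..T} \<Longrightarrow> 0 < q t"
  shows "0 < (LINT \<tau>:{0<..<T}|lebesgue. w (T - \<tau>) * q \<tau>)"
proof -
  obtain C where C: "\<And>x. x \<in> {0..T} \<Longrightarrow> \<bar>q x\<bar> \<le> C"
    using compact_imp_bounded[OF compact_continuous_image[OF q(1) compact_Icc]]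
    unfolding bounded_iff by (metis imageI real_norm_def)
  have C0: "0 \<le> C" using C[of 0] pos by force
  \<comment> \<open>the factor \<open>e\<^sup>-\<^sup>t\<close> makes \<open>h\<close> integrable on the whole line, so that it can be reflected\<close>
  define h where "h = (\<lambda>t. indicator {0<..} t *\<^sub>R (exp (- t) * w t))"
  have "h \<in> borel_measurable lborel" unfolding h_def
    using w_cont by (simp, intro borel_measurable_continuous_on_indicator[where 'b=real, simplified] continuous_intros) auto
  moreover have "integrable lebesgue h"
    using w_laplace[of 1] by (simp add: h_def laplace_exists_def set_integrable_def)
  ultimately have "integrable lborel h" by (simp add: integrable_completion)
  then have "integrable lborel (\<lambda>\<tau>. h (T + (-1) * \<tau>))" by (rule lborel_integrable_real_affine) simp
  then have "integrable lebesgue (\<lambda>\<tau>. h (T - \<tau>))"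
    by (subst integrable_completion) auto
  then have "set_integrable lebesgue {0<..<T} (\<lambda>\<tau>. h (T - \<tau>))"
    unfolding set_integrable_def by (intro integrable_mult_indicator) auto
  then have hint: "set_integrable lebesgue {0<..<T} (\<lambda>\<tau>. C * exp T * h (T - \<tau>))"
    by (rule set_integrable_mult_right)
  have cont: "continuous_on {0<..<T} (\<lambda>\<tau>. w (T - \<tau>))"
    by (intro continuous_on_compose2[OF w_cont] continuous_intros) auto
  have "set_borel_measurable lebesgue {0<..<T} (\<lambda>\<tau>. w (T - \<tau>) * q \<tau>)"
    by (intro set_borel_measurable_lebesgue_continuous continuous_intros cont
      continuous_on_subset[OF q(1)]) auto
  then have int: "set_integrable lebesgue {0<..<T} (\<lambda>\<tau>. w (T - \<tau>) * q \<tau>)"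
  proof (rule set_integrable_bound[OF hint], intro AE_I2 impI)
    fix \<tau> assume \<tau>: "\<tau> \<in> {0<..<T}"
    have h: "C * exp T * h (T - \<tau>) = w (T - \<tau>) * (C * exp \<tau>)"
      using \<tau> by (simp add: h_def exp_diff exp_minus field_simps)
    have "\<bar>q \<tau>\<bar> \<le> \<bar>C * exp \<tau>\<bar>"
      using C[of \<tau>] \<tau> C0 mult_left_mono[of 1 "exp \<tau>" C] by auto
    then have "\<bar>w (T - \<tau>)\<bar> * \<bar>q \<tau>\<bar> \<le> \<bar>w (T - \<tau>)\<bar> * \<bar>C * exp \<tau>\<bar>"
      by (rule mult_left_mono) simp
    then show "norm (w (T - \<tau>) * q \<tau>) \<le> norm (C * exp T * h (T - \<tau>))"
      unfolding h real_norm_def by (simp only: abs_mult)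
  qed
  have "open ({0<..<T} \<inter> (\<lambda>\<tau>. w (T - \<tau>)) -` {0<..})"
    using cont by (intro continuous_open_preimage) auto
  moreover have "T - t\<^sub>0 \<in> {0<..<T} \<inter> (\<lambda>\<tau>. w (T - \<tau>)) -` {0<..}" using pos by auto
  ultimately obtain d where d: "0 < d" "\<And>\<tau>. \<tau> \<in> ball (T - t\<^sub>0) d \<Longrightarrow> \<tau> \<in> {0<..<T} \<and> 0 < w (T - \<tau>)"
    unfolding open_contains_ball by blast
  have ball: "{T - t\<^sub>0 - d<..<T - t\<^sub>0 + d} = ball (T - t\<^sub>0) d"
    by (auto simp: dist_real_def)
  show ?thesis
  proof (rule set_integral_pos_interval[OF int, where a = "T - t\<^sub>0 - d" and b = "T - t\<^sub>0 + d"])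
    show "0 \<le> w (T - \<tau>) * q \<tau>" if "\<tau> \<in> {0<..<T}" for \<tau>
      using nonneg[of "T - \<tau>"] q(2)[of \<tau>] that by (intro mult_nonneg_nonneg) auto
    show "0 < w (T - \<tau>) * q \<tau>" if "\<tau> \<in> {T - t\<^sub>0 - d<..<T - t\<^sub>0 + d}" for \<tau>
      using d(2)[of \<tau>] q(2)[of \<tau>] that unfolding ball by auto
    show "{T - t\<^sub>0 - d<..<T - t\<^sub>0 + d} \<subseteq> {0<..<T}" unfolding ball using d(2) by blast
  qed (use d in auto)
qed

end


section \<open>Positivity of the impulse response\<close>

lemma impulse_response_convolution_pos:
  assumes w: "impulse_response k \<mu> w" and \<mu>: "0 < \<mu>"
    and k: "\<And>t. 0 < t \<Longrightarrow> 0 \<le> k t" "stieltjes_function (laplace k)" "(laplace k \<longlongrightarrow> 0) at_top"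
    and T: "0 < T" and q: "continuous_on {0..T} q" "\<And>t. t \<in> {0..T} \<Longrightarrow> 0 < q t"
  shows "0 < (LINT \<tau>:{0<..<T}|lebesgue. w (T - \<tau>) * q \<tau>)"
proof -
  have cont: "continuous_on {0<..} w" and L: "\<And>s. 0 < s \<Longrightarrow> laplace_exists w s"
    and F: "\<And>s. 0 < s \<Longrightarrow> laplace w s = 1 / (s * laplace k s + \<mu>)"
    using w unfolding impulse_response_def by auto
  have k0: "0 \<le> laplace k s" for s
    unfolding laplace_def set_lebesgue_integral_def using k(1)
    by (intro Bochner_Integration.integral_nonneg) (auto simp: indicator_def)
  have "(\<lambda>n. laplace w (1 + real n)) = (\<lambda>n. 1 / ((1 + real n) * laplace k (1 + real n) + \<mu>))"
    using F by auto
  then have "cm_seq m (\<lambda>n. laplace w (1 + real n))" for m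
    using relaxation_symbol_cm_seq[OF k(2) k0 \<mu>] by simp
  then have nonneg: "0 \<le> w t" if "0 < t" for t
    using nonneg_if_cm_laplace[OF cont L] that by blast
  have "eventually (\<lambda>s. laplace k s < 1) at_top"
    using k(3) by (rule order_tendstoD) simp
  with eventually_gt_at_top[of 0] have "eventually (\<lambda>s. 1 / (s + \<mu>) \<le> laplace w s) at_top"
  proof eventually_elim
    case (elim s)
    then have "s * laplace k s \<le> s" by (simp add: mult_left_le)
    then show ?case using elim F[of s] k0[of s] \<mu>
      by (simp add: frac_le add_nonneg_pos)
  qed
  from positive_near_zero[OF cont L nonneg this T]
  obtain t\<^sub>0 where "t\<^sub>0 \<in> {0<..<T}" "0 < w t\<^sub>0" by blast
  then show ?thesis by (intro convolution_pos[OF cont L nonneg] q)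
qed

section \<open>Orthonormal expansions in the space of square integrable functions\<close>

lemma L2_mult_integrable:
  assumes "f \<in> L2 \<Omega>" "g \<in> L2 \<Omega>"
  shows "integrable (lebesgue_on \<Omega>) (\<lambda>x. f x * g x)"
proof (rule Bochner_Integration.integrable_bound)
  show "integrable (lebesgue_on \<Omega>) (\<lambda>x. (f x)\<^sup>2 + (g x)\<^sup>2)"
    using assms by (auto simp: L2_def)
  show "(\<lambda>x. f x * g x) \<in> borel_measurable (lebesgue_on \<Omega>)"
    using assms by (auto simp: L2_def)
  have "\<bar>a * b\<bar> \<le> a\<^sup>2 + b\<^sup>2" for a b :: real
  proof -
    have "2 * (\<bar>a\<bar> * \<bar>b\<bar>) \<le> a\<^sup>2 + b\<^sup>2" using sum_squares_bound[of "\<bar>a\<bar>" "\<bar>b\<bar>"] by (simp add: mult.assoc)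
    moreover have "0 \<le> \<bar>a\<bar> * \<bar>b\<bar>" by simp
    ultimately show ?thesis unfolding abs_mult by linarith
  qed
  then show "AE x in lebesgue_on \<Omega>. norm (f x * g x) \<le> norm ((f x)\<^sup>2 + (g x)\<^sup>2)" by simp
qed

lemma L2_scale: "f \<in> L2 \<Omega> \<Longrightarrow> (\<lambda>x. c * f x) \<in> L2 \<Omega>"
  by (auto simp: L2_def power_mult_distrib)

lemma L2_add:
  assumes "f \<in> L2 \<Omega>" "g \<in> L2 \<Omega>" shows "(\<lambda>x. f x + g x) \<in> L2 \<Omega>"
proof -
  have "integrable (lebesgue_on \<Omega>) (\<lambda>x. (f x)\<^sup>2 + (g x)\<^sup>2 + 2 * (f x * g x))"
    using assms L2_mult_integrable[OF assms]
    by (intro Bochner_Integration.integrable_add integrable_mult_right) (auto simp: L2_def)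
  also have "(\<lambda>x. (f x)\<^sup>2 + (g x)\<^sup>2 + 2 * (f x * g x)) = (\<lambda>x. (f x + g x)\<^sup>2)"
    by (simp add: power2_sum mult.assoc)
  finally show ?thesis using assms by (auto simp: L2_def)
qed

lemma L2_diff: "f \<in> L2 \<Omega> \<Longrightarrow> g \<in> L2 \<Omega> \<Longrightarrow> (\<lambda>x. f x - g x) \<in> L2 \<Omega>"
  using L2_add[of f \<Omega> "\<lambda>x. -1 * g x"] L2_scale[of g \<Omega> "-1"] by simp

lemma L2_sum: "(\<And>i. \<phi> i \<in> L2 \<Omega>) \<Longrightarrow> (\<lambda>x. \<Sum>i<(N::nat). c i * \<phi> i x) \<in> L2 \<Omega>"
proof (induction N)
  case 0
  show ?case by (simp add: L2_def)
next
  case (Suc N)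
  then show ?case by (simp add: L2_add L2_scale)
qed

lemma L2_inner_commute: "L2_inner \<Omega> f g = L2_inner \<Omega> g f"
  by (simp add: L2_inner_def mult.commute)

lemma L2_inner_scale_left: "L2_inner \<Omega> (\<lambda>x. c * f x) g = c * L2_inner \<Omega> f g"
  by (simp add: L2_inner_def mult.assoc)

lemma L2_inner_diff_left:
  assumes "f \<in> L2 \<Omega>" "g \<in> L2 \<Omega>" "h \<in> L2 \<Omega>"
  shows "L2_inner \<Omega> (\<lambda>x. f x - g x) h = L2_inner \<Omega> f h - L2_inner \<Omega> g h"
  using Bochner_Integration.integral_diff[OF L2_mult_integrable[OF assms(1,3)] L2_mult_integrable[OF assms(2,3)]]
  by (simp add: L2_inner_def left_diff_distrib)

lemma L2_inner_sum_left:
  assumes "\<And>i. \<phi> i \<in> L2 \<Omega>" "h \<in> L2 \<Omega>"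
  shows "L2_inner \<Omega> (\<lambda>x. \<Sum>i<(N::nat). c i * \<phi> i x) h = (\<Sum>i<N. c i * L2_inner \<Omega> (\<phi> i) h)"
proof -
  have "L2_inner \<Omega> (\<lambda>x. \<Sum>i<N. c i * \<phi> i x) h = (\<Sum>i<N. LINT x|lebesgue_on \<Omega>. c i * (\<phi> i x * h x))"
    unfolding L2_inner_def sum_distrib_right mult.assoc
    by (intro Bochner_Integration.integral_sum integrable_mult_right L2_mult_integrable assms)
  then show ?thesis by (simp add: L2_inner_def)
qed

lemma L2_inner_self_nonneg: "0 \<le> L2_inner \<Omega> f f"
  unfolding L2_inner_def by (rule Bochner_Integration.integral_nonneg) simp

lemma L2_inner_self_eq_0:
  assumes "f \<in> L2 \<Omega>" "L2_inner \<Omega> f f = 0"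
  shows "AE x in lebesgue_on \<Omega>. f x = 0"
  using integral_nonneg_eq_0_iff_AE[OF L2_mult_integrable[OF assms(1,1)]] assms(2)
  by (simp add: L2_inner_def)

lemma L2_Cauchy_Schwarz:
  assumes f: "f \<in> L2 \<Omega>" and g: "g \<in> L2 \<Omega>"
  shows "\<bar>L2_inner \<Omega> f g\<bar> \<le> L2_norm \<Omega> f * L2_norm \<Omega> g"
proof -
  define A B C where "A = L2_inner \<Omega> f f" and "B = L2_inner \<Omega> g g" and "C = L2_inner \<Omega> f g"
  have "C\<^sup>2 \<le> A * B"
  proof (cases "A = 0")
    case True
    then have "AE x in lebesgue_on \<Omega>. f x = 0" using L2_inner_self_eq_0[OF f] by (simp add: A_def)
    then have "C = 0" unfolding C_def L2_inner_def by (intro integral_eq_zero_AE) auto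
    then show ?thesis using True by simp
  next
    case False
    then have A: "0 < A" using L2_inner_self_nonneg[of \<Omega> f] by (simp add: A_def)
    define t where "t = C / A"
    have tf: "(\<lambda>x. t * f x) \<in> L2 \<Omega>" by (rule L2_scale[OF f])
    have "L2_inner \<Omega> (\<lambda>x. g x - t * f x) (\<lambda>x. g x - t * f x)
        = B - t * C - t * (C - t * A)"
      unfolding L2_inner_diff_left[OF g tf L2_diff[OF g tf]] L2_inner_scale_left
        L2_inner_commute[of \<Omega> g "\<lambda>x. g x - t * f x"] L2_inner_commute[of \<Omega> f "\<lambda>x. g x - t * f x"]
        L2_inner_diff_left[OF g tf g] L2_inner_diff_left[OF g tf f] A_def B_def C_def
      by (simp add: L2_inner_commute[of \<Omega> g f])
    then have "0 \<le> B - t * C - t * (C - t * A)" using L2_inner_self_nonneg by metis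
    then have "0 \<le> B - C * C / A" using A by (simp add: t_def)
    then show ?thesis using A by (simp add: field_simps power2_eq_square)
  qed
  then have "\<bar>C\<bar> \<le> sqrt (A * B)" using real_le_rsqrt[of "\<bar>C\<bar>"] by simp
  then show ?thesis by (simp add: A_def B_def C_def L2_norm_def real_sqrt_mult)
qed

text \<open>
  The coefficient functional is continuous, and it is constantly \<open>a m\<close> on the partial sums with more
  than \<open>m\<close> terms.
\<close>

lemma orthonormal_expansion_coeff:
  assumes \<phi>: "orthonormal_basis \<Omega> \<phi>" and u: "u \<in> L2 \<Omega>"
    and lim: "(\<lambda>N. L2_norm \<Omega> (\<lambda>x. u x - (\<Sum>n<N. a n * \<phi> n x))) \<longlonglongrightarrow> 0"
  shows "L2_inner \<Omega> u (\<phi> m) = a m"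
proof -
  have \<phi>2: "\<phi> n \<in> L2 \<Omega>" and on: "L2_inner \<Omega> (\<phi> m) (\<phi> n) = (if m = n then 1 else 0)" for m n
    using \<phi> by (auto simp: orthonormal_basis_def)
  have "\<bar>L2_inner \<Omega> u (\<phi> m) - a m\<bar> \<le> L2_norm \<Omega> (\<lambda>x. u x - (\<Sum>n<N. a n * \<phi> n x))" if "m < N" for N
  proof -
    have "L2_inner \<Omega> (\<lambda>x. \<Sum>n<N. a n * \<phi> n x) (\<phi> m) = a m"
      unfolding L2_inner_sum_left[OF \<phi>2 \<phi>2] on using that by (simp add: if_distrib cong: if_cong)
    then have "L2_inner \<Omega> u (\<phi> m) - a m = L2_inner \<Omega> (\<lambda>x. u x - (\<Sum>n<N. a n * \<phi> n x)) (\<phi> m)"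
      by (simp add: L2_inner_diff_left[OF u L2_sum[OF \<phi>2] \<phi>2])
    then show ?thesis
      using L2_Cauchy_Schwarz[OF L2_diff[OF u L2_sum[where \<phi> = \<phi> and N = N and c = a, OF \<phi>2]] \<phi>2[of m]] on[of m m]
      by (simp add: L2_norm_def)
  qed
  then have "\<bar>L2_inner \<Omega> u (\<phi> m) - a m\<bar> \<le> 0"
    by (intro tendsto_lowerbound[OF lim]) (auto intro: eventually_mono[OF eventually_gt_at_top[of m]])
  then show ?thesis by simp
qed

text \<open>
  If \<open>f\<close> is orthogonal to all \<open>\<phi>\<^sub>n\<close>, then \<open>\<parallel>f\<parallel>\<^sup>2 = (f - S, f) \<le> \<parallel>f - S\<parallel> \<parallel>f\<parallel>\<close> for every finite linear combination
  \<open>S\<close>, and \<open>\<parallel>f - S\<parallel>\<close> can be made arbitrarily small.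
\<close>

lemma orthonormal_basis_complete:
  assumes \<phi>: "orthonormal_basis \<Omega> \<phi>" and f: "f \<in> L2 \<Omega>" and orth: "\<And>n. L2_inner \<Omega> f (\<phi> n) = 0"
  shows "AE x in lebesgue_on \<Omega>. f x = 0"
proof -
  have \<phi>2: "\<phi> n \<in> L2 \<Omega>" for n
    using \<phi> by (auto simp: orthonormal_basis_def)
  define A where "A = L2_norm \<Omega> f"
  have orth': "L2_inner \<Omega> (\<phi> n) f = 0" for n
    using orth[of n] by (simp add: L2_inner_commute)
  have A: "0 \<le> A" "A * A = L2_inner \<Omega> f f" using L2_inner_self_nonneg[of \<Omega> f] by (auto simp: A_def L2_norm_def)
  have "A \<le> 0 + \<epsilon>" if \<epsilon>: "0 < \<epsilon>" for \<epsilon>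
  proof -
    obtain N c where N: "L2_norm \<Omega> (\<lambda>x. f x - (\<Sum>n<N. c n * \<phi> n x)) < \<epsilon>"
      using \<phi> f \<epsilon> unfolding orthonormal_basis_def by blast
    have "L2_inner \<Omega> (\<lambda>x. f x - (\<Sum>n<N. c n * \<phi> n x)) f = A * A"
      unfolding L2_inner_diff_left[OF f L2_sum[OF \<phi>2] f] L2_inner_sum_left[OF \<phi>2 f]
      using A orth' by simp
    then have "A * A \<le> L2_norm \<Omega> (\<lambda>x. f x - (\<Sum>n<N. c n * \<phi> n x)) * A"
      using L2_Cauchy_Schwarz[OF L2_diff[OF f L2_sum[where \<phi> = \<phi> and N = N and c = c, OF \<phi>2]] f] by (simp add: A_def)
    also have "\<dots> \<le> \<epsilon> * A" using N A by (intro mult_right_mono) auto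
    finally have "A * A \<le> \<epsilon> * A" .
    then show ?thesis using A(1) \<epsilon> mult_right_le_imp_le[of A A \<epsilon>] by (cases "A = 0") auto
  qed
  then have "A \<le> 0" by (rule field_le_epsilon)
  then show ?thesis using A L2_inner_self_eq_0[OF f] by simp
qed

lemma L2_eq_if_coeffs_eq:
  assumes "orthonormal_basis \<Omega> \<phi>" "f \<in> L2 \<Omega>" "g \<in> L2 \<Omega>"
    and "\<And>n. L2_inner \<Omega> f (\<phi> n) = L2_inner \<Omega> g (\<phi> n)"
  shows "AE x in lebesgue_on \<Omega>. f x = g x"
proof -
  have "\<phi> n \<in> L2 \<Omega>" for n using assms(1) by (auto simp: orthonormal_basis_def)
  then have "AE x in lebesgue_on \<Omega>. f x - g x = 0"
    using assms by (intro orthonormal_basis_complete[OF assms(1)] L2_diff) (simp_all add: L2_inner_diff_left)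
  then show ?thesis by simp
qed

section \<open>Uniqueness for the inverse source problem\<close>

theorem mainTheorem3:
  fixes k q :: "real \<Rightarrow> real" and v :: "real \<Rightarrow> real \<Rightarrow> real"
    and \<Omega> :: "'a::euclidean_space set" and lam :: "nat \<Rightarrow> real" and \<phi> :: "nat \<Rightarrow> 'a \<Rightarrow> real"
    and T q\<^sub>0 :: real and h f\<^sub>1 f\<^sub>2 :: "'a \<Rightarrow> real" and u\<^sub>1 u\<^sub>2 :: "'a \<Rightarrow> real \<Rightarrow> real"
  assumes "\<And>b. 0 < b \<Longrightarrow> set_integrable lebesgue {0..b} k"
    and "\<And>t. 0 < t \<Longrightarrow> 0 \<le> k t"
    and "\<And>s. 0 < s \<Longrightarrow> laplace_exists k s"
    and "stieltjes_function (laplace k)"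
    and "(laplace k \<longlongrightarrow> 0) at_top"
    and "filterlim (\<lambda>s. s * laplace k s) at_top at_top"
    and "filterlim (laplace k) at_top (at_right 0)"
    and "((\<lambda>s. s * laplace k s) \<longlongrightarrow> 0) (at_right 0)"
    and "\<And>\<mu>. 0 < \<mu> \<Longrightarrow> impulse_response k \<mu> (\<lambda>t. v t \<mu>)"
    and "open \<Omega>" and "connected \<Omega>" and "\<Omega> \<noteq> {}" and "bounded \<Omega>" and "Ck_boundary 2 \<Omega>"
    and "dirichlet_eigensystem \<Omega> lam \<phi>"
    and "0 < T" and "continuous_on {0..T} q" and "0 < q\<^sub>0" and "\<And>t. t \<in> {0..T} \<Longrightarrow> q\<^sub>0 \<le> q t"
    and "inverse_source_solution \<Omega> lam \<phi> v T q h f\<^sub>1 u\<^sub>1"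
    and "inverse_source_solution \<Omega> lam \<phi> v T q h f\<^sub>2 u\<^sub>2"
  shows "(AE x in lebesgue_on \<Omega>. f\<^sub>1 x = f\<^sub>2 x) \<and>
    (\<forall>t\<in>{0..T}. AE x in lebesgue_on \<Omega>. u\<^sub>1 x t = u\<^sub>2 x t)"
proof -
  have onb: "orthonormal_basis \<Omega> \<phi>" and lam: "0 < lam n" for n
    using assms(15) unfolding dirichlet_eigensystem_def
    by (auto intro: less_le_trans[of 0 "lam 0"] simp: incseq_def)
  have \<phi>2: "\<phi> n \<in> L2 \<Omega>" for n using onb by (auto simp: orthonormal_basis_def)
  define c where "c = (\<lambda>n t. LINT \<tau>:{0<..<t}|lebesgue. v (t - \<tau>) (lam n) * q \<tau>)"
  have c_pos: "0 < c n T" for n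
    unfolding c_def
    using assms(18,19)
    by (intro impulse_response_convolution_pos[OF assms(9)[OF lam] lam assms(2,4,5,16,17)]) force+
  have coeff: "f \<in> L2 \<Omega>" "(\<lambda>x. u x t) \<in> L2 \<Omega>"
      "L2_inner \<Omega> (\<lambda>x. u x t) (\<phi> n) = L2_inner \<Omega> f (\<phi> n) * c n t"
    if "inverse_source_solution \<Omega> lam \<phi> v T q h f u" "t \<in> {0..T}" for f u t n
    using that orthonormal_expansion_coeff[OF onb, of "\<lambda>x. u x t" "\<lambda>n. L2_inner \<Omega> f (\<phi> n) * c n t"]
    unfolding inverse_source_solution_def direct_solution_def c_def by auto
  note coeff1 = coeff[OF assms(20)] and coeff2 = coeff[OF assms(21)]
  have T: "T \<in> {0..T}" using assms(16) by simp
  have "AE x in lebesgue_on \<Omega>. u\<^sub>1 x T = h x" "AE x in lebesgue_on \<Omega>. u\<^sub>2 x T = h x"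
    using assms(20,21) by (auto simp: inverse_source_solution_def)
  then have uT: "AE x in lebesgue_on \<Omega>. u\<^sub>1 x T = u\<^sub>2 x T" by eventually_elim simp
  have feq: "L2_inner \<Omega> f\<^sub>1 (\<phi> n) = L2_inner \<Omega> f\<^sub>2 (\<phi> n)" for n
  proof -
    have "L2_inner \<Omega> (\<lambda>x. u\<^sub>1 x T) (\<phi> n) = L2_inner \<Omega> (\<lambda>x. u\<^sub>2 x T) (\<phi> n)"
      unfolding L2_inner_def
    proof (rule integral_cong_AE)
      show "AE x in lebesgue_on \<Omega>. u\<^sub>1 x T * \<phi> n x = u\<^sub>2 x T * \<phi> n x"
        using uT by eventually_elim simp
    qed (use coeff1(2)[OF T] coeff2(2)[OF T] \<phi>2 L2_mult_integrable in blast)+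
    then show ?thesis using coeff1(3)[OF T] coeff2(3)[OF T] c_pos[of n] by simp
  qed
  have "AE x in lebesgue_on \<Omega>. f\<^sub>1 x = f\<^sub>2 x"
    by (rule L2_eq_if_coeffs_eq[OF onb coeff1(1)[OF T] coeff2(1)[OF T] feq])
  moreover have "AE x in lebesgue_on \<Omega>. u\<^sub>1 x t = u\<^sub>2 x t" if "t \<in> {0..T}" for t
    using coeff1[OF that] coeff2[OF that] by (intro L2_eq_if_coeffs_eq[OF onb]) (simp_all add: feq)
  ultimately show ?thesis by blast
qed

end
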